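(* Let $N\ge 2$, let $p>1$ if $N=2$, or $1<p\le\frac{N}{N-2}$ if $N\ge 3$, let $q=\frac{2p}{p+1}$ and $M>-\mu^*$, where $$\mu^*:=\mu^*(N)=(p+1)\left(\frac{N-(N-2)p}{2p}\right)^{\frac{p}{p+1}} .$$ Then there exists no nontrivial nonnegative supersolution of $$-\Delta u=|u|^{p-1}u+M|\nabla u|^q$$ in an exterior domain of $\mathbb{R}^N$.
   Context: An exterior domain is a connected open set which is the complement of a compact subset of $\mathbb{R}^N$. A (classical, $C^2$) supersolution is a function satisfying $-\Delta u\ge |u|^{p-1}u+M|\nabla u|^q$. Nontrivial means not identically zero. *)

theory Defs
  imports "HOL-Analysis.Analysis"
begin

text \<open>Partial derivative of \<open>f\<close> in direction \<open>i\<close>. It is only meaningful where \<open>f\<close> is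
  (Frechet) differentiable, which \<open>C2_on\<close> below guarantees wherever it is used.\<close>

definition partial_deriv :: "'a::euclidean_space \<Rightarrow> ('a \<Rightarrow> real) \<Rightarrow> 'a \<Rightarrow> real" where
  "partial_deriv i f x = frechet_derivative f (at x) i"

definition gradient :: "('a::euclidean_space \<Rightarrow> real) \<Rightarrow> 'a \<Rightarrow> 'a" where
  "gradient f x = (\<Sum>i\<in>Basis. partial_deriv i f x *\<^sub>R i)"

definition laplacian :: "('a::euclidean_space \<Rightarrow> real) \<Rightarrow> 'a \<Rightarrow> real" where
  "laplacian f x = (\<Sum>i\<in>Basis. partial_deriv i (partial_deriv i f) x)"

text \<open>\<open>f\<close> is of class \<open>C\<^sup>2\<close> on an open set \<open>S\<close>: \<open>f\<close> and its first partial derivatives are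
  differentiable (so in particular continuous), and the second partial derivatives are
  continuous.\<close>

definition C2_on :: "'a::euclidean_space set \<Rightarrow> ('a \<Rightarrow> real) \<Rightarrow> bool" where
  "C2_on S f \<longleftrightarrow>
     (\<forall>x\<in>S. f differentiable (at x)) \<and>
     (\<forall>i\<in>Basis. \<forall>x\<in>S. partial_deriv i f differentiable (at x)) \<and>
     (\<forall>i\<in>Basis. \<forall>j\<in>Basis. continuous_on S (partial_deriv j (partial_deriv i f)))"

definition exterior_domain :: "'a::euclidean_space set \<Rightarrow> bool" where
  "exterior_domain \<Omega> \<longleftrightarrow> open \<Omega> \<and> connected \<Omega> \<and> (\<exists>K. compact K \<and> \<Omega> = - K)"

definition supersolution ::
    "real \<Rightarrow> real \<Rightarrow> real \<Rightarrow> 'a::euclidean_space set \<Rightarrow> ('a \<Rightarrow> real) \<Rightarrow> bool" where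
  "supersolution p q M \<Omega> u \<longleftrightarrow>
     C2_on \<Omega> u \<and>
     (\<forall>x\<in>\<Omega>. - laplacian u x \<ge> \<bar>u x\<bar> powr (p - 1) * u x + M * norm (gradient u x) powr q)"

text \<open>For \<open>N = 2\<close> and \<open>p > 1\<close>, and for \<open>N \<ge> 3\<close> and \<open>1 < p \<le> N / (N - 2)\<close>, the base of
  the power is nonnegative; it vanishes exactly when \<open>N \<ge> 3\<close> and \<open>p = N / (N - 2)\<close>, where
  \<open>0 powr a = 0\<close> gives the intended value \<open>0\<close>.\<close>

definition mu_star :: "nat \<Rightarrow> real \<Rightarrow> real" where
  "mu_star N p =
     (p + 1) * ((real N - (real N - 2) * p) / (2 * p)) powr (p / (p + 1))"

end

theory Submission
  imports Defs
begin

text \<open>By Young's inequality, \<open>M > - \<mu>\<^sup>*\<close> gives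
  \<open>u\<^sup>p + M |\<nabla>u|\<^sup>q \<ge> e u\<^sup>p - c |\<nabla>u|\<^sup>2 / u\<close> with \<open>e > 0\<close>, \<open>0 \<le> c < 1\<close> and
  \<open>c \<le> (N - (N - 2) p) / 2\<close>; \<open>M = - \<mu>\<^sup>*\<close> is exactly the case where \<open>e = 0\<close> and equality in
  the bound on \<open>c\<close> are forced. With \<open>s = 1 - c\<close>, the function \<open>v = u\<^sup>s\<close> then satisfies \<open>- \<Delta>v \<ge> s e v\<^sup>P\<close> for
  \<open>P = (p + s - 1) / s\<close>, and the bound on \<open>c\<close> says that \<open>\<beta> := 2 / (P - 1) \<ge> N - 2\<close>.
  Comparison in the exterior of a ball yields \<open>v \<ge> C |x| powr (- \<beta>)\<close>, and feeding this into the
  inequality improves it to \<open>v \<ge> t |x| powr (- \<beta>) ln |x|\<close>. On the other hand, touching \<open>v\<close> from below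
  in the ball of radius \<open>r\<close> about a point at distance \<open>2 r\<close> from the origin by a multiple of
  \<open>(r\<^sup>2 - |x - y|\<^sup>2)\<^sup>2\<close> produces a point of that ball at which \<open>v \<le> C r powr (- \<beta>)\<close>,
  a contradiction for large \<open>r\<close>.\<close>

subsection \<open>Touching by radial functions\<close>

text \<open>Since \<open>F'\<close> is assumed differentiable only at 0, the sign of
  \<open>D\<close> comes from monotonicity rather than a Taylor expansion: with \<open>D < 0\<close>
  and \<open>F' 0 = 0\<close>, \<open>F'\<close> would be negative just to the right of 0 and
  \<open>F\<close> would drop below its minimum.\<close>

lemma local_minimum_second_derivative:
  fixes F F' :: "real \<Rightarrow> real"
  assumes "e > 0"
    and F: "\<And>t. \<bar>t\<bar> < e \<Longrightarrow> (F has_real_derivative F' t) (at t)"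
    and F': "(F' has_real_derivative D) (at 0)"
    and min: "\<And>t. \<bar>t\<bar> < e \<Longrightarrow> F 0 \<le> F t"
  shows "F' 0 = 0" and "0 \<le> D"
proof -
  show zero: "F' 0 = 0"
    using DERIV_local_min[of F "F' 0" 0 e] F[of 0] min \<open>e > 0\<close> by simp
  show "0 \<le> D"
  proof (rule ccontr)
    assume "\<not> 0 \<le> D"
    with DERIV_neg_dec_right[OF F'] obtain d
      where d: "d > 0" "\<And>h. 0 < h \<Longrightarrow> h < d \<Longrightarrow> F' h < F' 0" by auto
    define t where "t = min d e / 2"
    have t: "0 < t" "t < d" "t < e" using d(1) \<open>e > 0\<close> by (auto simp: t_def)
    have "F t < F 0"
    proof (rule DERIV_neg_imp_decreasing_open[OF t(1)])
      fix r assume "0 < r" "r < t"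
      then show "\<exists>y. (F has_real_derivative y) (at r) \<and> y < 0"
        using F[of r] d(2)[of r] t zero by (intro exI[of _ "F' r"]) auto
    next
      show "continuous_on {0..t} F"
        using F t by (intro continuous_at_imp_continuous_on ballI DERIV_isCont[OF F]) auto
    qed
    with min[of t] t show False by simp
  qed
qed

lemma C2_on_subset: "C2_on S f \<Longrightarrow> T \<subseteq> S \<Longrightarrow> C2_on T f"
  unfolding C2_on_def by (blast intro: continuous_on_subset)

lemma C2_on_imp_continuous_on: "C2_on S f \<Longrightarrow> continuous_on S f"
  unfolding C2_on_def
  by (meson continuous_at_imp_continuous_on differentiable_imp_continuous_within)

lemma inner_gradient: "i \<in> Basis \<Longrightarrow> gradient f x \<bullet> i = partial_deriv i f x"
  unfolding gradient_def by (simp add: inner_sum_left inner_Basis if_distrib cong: if_cong)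

lemma power2_norm_gradient: "(norm (gradient f x))\<^sup>2 = (\<Sum>i\<in>Basis. (partial_deriv i f x)\<^sup>2)"
  unfolding power2_norm_eq_inner euclidean_inner[of "gradient f x" "gradient f x"]
  by (simp add: inner_gradient power2_eq_square)

lemma has_real_derivative_along_line:
  assumes "f differentiable (at (x + t *\<^sub>R i))"
  shows "((\<lambda>t. f (x + t *\<^sub>R i)) has_real_derivative partial_deriv i f (x + t *\<^sub>R i)) (at t)"
proof -
  have "((\<lambda>t. x + t *\<^sub>R i) has_derivative (\<lambda>h. h *\<^sub>R i)) (at t)"
    by (auto intro!: derivative_eq_intros)
  from has_derivative_compose[OF this] assms
  have "((\<lambda>t. f (x + t *\<^sub>R i)) has_derivative
      (\<lambda>h. frechet_derivative f (at (x + t *\<^sub>R i)) (h *\<^sub>R i))) (at t)"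
    unfolding frechet_derivative_works .
  moreover have "frechet_derivative f (at (x + t *\<^sub>R i)) (h *\<^sub>R i) =
      partial_deriv i f (x + t *\<^sub>R i) * h" for h
    using linear_frechet_derivative[OF assms] by (simp add: partial_deriv_def linear_cmul)
  ultimately show ?thesis by (simp add: has_field_derivative_def)
qed

text \<open>Restrict \<open>h (u z) - g (k z y)\<close> to each coordinate line through
  \<open>x\<close>: the first derivative vanishes, the second is nonnegative, and summing over the
  basis gives both claims. The outer function \<open>h\<close> allows powers of \<open>u\<close> to
  be tested without computing their partial derivatives.\<close>

lemma touching_radial:
  fixes u :: "'a::euclidean_space \<Rightarrow> real"
  defines "k \<equiv> \<lambda>z y::'a. (norm (z - y))\<^sup>2"
  assumes "C2_on S u" "open S" "x \<in> S"
    and "open A" "u x \<in> A" "\<And>r. r \<in> A \<Longrightarrow> (h has_real_derivative h' r) (at r)"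
    and h'': "(h' has_real_derivative h'') (at (u x))"
    and "open B" "k x y \<in> B" "\<And>r. r \<in> B \<Longrightarrow> (g has_real_derivative g' r) (at r)"
    and g'': "(g' has_real_derivative g'') (at (k x y))"
    and min: "\<And>z. z \<in> S \<Longrightarrow> h (u x) - g (k x y) \<le> h (u z) - g (k z y)"
  shows "h' (u x) *\<^sub>R gradient u x = (2 * g' (k x y)) *\<^sub>R (x - y)"
    and "2 * real DIM('a) * g' (k x y) + 4 * k x y * g''
      \<le> h' (u x) * laplacian u x + h'' * (norm (gradient u x))\<^sup>2"
proof -
  have first_second: "h' (u x) * partial_deriv i u x = 2 * g' (k x y) * ((x - y) \<bullet> i) \<and>
      2 * g' (k x y) + 4 * ((x - y) \<bullet> i)\<^sup>2 * g''
        \<le> h' (u x) * partial_deriv i (partial_deriv i u) x + h'' * (partial_deriv i u x)\<^sup>2"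
    if i: "i \<in> Basis" for i
  proof -
    define U where "U t = u (x + t *\<^sub>R i)" for t
    define U' where "U' t = partial_deriv i u (x + t *\<^sub>R i)" for t
    define K where "K t = k (x + t *\<^sub>R i) y" for t
    define K' where "K' t = 2 * ((x - y) \<bullet> i) + 2 * t" for t
    have K: "K t = k x y + 2 * t * ((x - y) \<bullet> i) + t\<^sup>2" for t
    proof -
      have "x + t *\<^sub>R i - y = (x - y) + t *\<^sub>R i" by simp
      then show ?thesis
        unfolding K_def k_def power2_norm_eq_inner
        using i by (simp add: inner_add_left inner_add_right inner_commute power2_eq_square
            algebra_simps)
    qed
    have contK: "isCont K 0" unfolding K by (intro continuous_intros)
    have contX: "isCont (\<lambda>t. x + t *\<^sub>R i) 0" by (intro continuous_intros)
    have dU: "(U has_real_derivative U' t) (at t)" if "x + t *\<^sub>R i \<in> S" for t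
      unfolding U_def U'_def using assms(2) that
      by (intro has_real_derivative_along_line) (auto simp: C2_on_def)
    have dU': "(U' has_real_derivative partial_deriv i (partial_deriv i u) x) (at 0)"
      using has_real_derivative_along_line[of "partial_deriv i u" x 0 i] assms(2,4) i
      unfolding U'_def by (auto simp: C2_on_def)
    have dK: "(K has_real_derivative K' t) (at t)" for t
      unfolding K K'_def by (auto intro!: derivative_eq_intros)
    have dK': "(K' has_real_derivative 2) (at 0)"
      unfolding K'_def by (auto intro!: derivative_eq_intros)
    have contU: "isCont U 0"
      using dU[of 0] assms(4) by (auto intro: DERIV_isCont)
    have "\<forall>\<^sub>F t in nhds 0. x + t *\<^sub>R i \<in> S \<and> U t \<in> A \<and> K t \<in> B"
    proof (intro eventually_conj)
      show "\<forall>\<^sub>F t in nhds 0. x + t *\<^sub>R i \<in> S"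
        using contX assms(3,4) by (auto simp: continuous_at_open eventually_nhds)
      show "\<forall>\<^sub>F t in nhds 0. U t \<in> A"
        using contU assms(5,6) by (auto simp: continuous_at_open eventually_nhds U_def)
      show "\<forall>\<^sub>F t in nhds 0. K t \<in> B"
        using contK assms(9,10) by (auto simp: continuous_at_open eventually_nhds K_def)
    qed
    then obtain e where e: "e > 0"
      "\<And>t. \<bar>t\<bar> < e \<Longrightarrow> x + t *\<^sub>R i \<in> S \<and> U t \<in> A \<and> K t \<in> B"
      unfolding eventually_nhds_metric by (auto simp: dist_real_def)
    define F where "F t = h (U t) - g (K t)" for t
    define F' where "F' t = h' (U t) * U' t - g' (K t) * K' t" for t
    have dF: "(F has_real_derivative F' t) (at t)" if "\<bar>t\<bar> < e" for t
      unfolding F_def F'_def using e(2)[OF that]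
      by (intro DERIV_diff DERIV_chain2[where f = h and g = U] DERIV_chain2[where f = g and g = K]
          assms(7,11) dU dK) simp_all
    have h0: "(h' has_real_derivative h'') (at (U 0))"
      using h'' by (simp add: U_def)
    have g0: "(g' has_real_derivative g'') (at (K 0))"
      using g'' by (simp add: K_def)
    have dF': "(F' has_real_derivative
       (h'' * U' 0 * U' 0 + partial_deriv i (partial_deriv i u) x * h' (U 0)) -
       (g'' * K' 0 * K' 0 + 2 * g' (K 0))) (at 0)"
      unfolding F'_def using dU[of 0] assms(4)
      by (intro DERIV_diff DERIV_mult DERIV_chain2[where f = h' and g = U, OF h0] DERIV_chain2[where f = g' and g = K, OF g0] dU' dK dK') auto
    have minF: "F 0 \<le> F t" if "\<bar>t\<bar> < e" for t
      using min[of "x + t *\<^sub>R i"] e(2)[OF that] unfolding F_def U_def K_def by simp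
    have "F' 0 = 0"
      by (rule local_minimum_second_derivative(1)[OF e(1) dF dF' minF])
    moreover have "0 \<le> (h'' * U' 0 * U' 0 + partial_deriv i (partial_deriv i u) x * h' (U 0)) -
       (g'' * K' 0 * K' 0 + 2 * g' (K 0))"
      by (rule local_minimum_second_derivative(2)[OF e(1) dF dF' minF])
    ultimately show ?thesis
      by (simp add: F'_def U_def U'_def K_def K'_def power2_eq_square algebra_simps)
  qed
  show "h' (u x) *\<^sub>R gradient u x = (2 * g' (k x y)) *\<^sub>R (x - y)"
    by (rule euclidean_eqI) (use first_second in \<open>simp add: inner_gradient\<close>)
  have "2 * real DIM('a) * g' (k x y) + 4 * k x y * g'' =
      (\<Sum>i\<in>Basis. 2 * g' (k x y) + 4 * ((x - y) \<bullet> i)\<^sup>2 * g'')"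
    unfolding k_def power2_norm_eq_inner euclidean_inner[of "x - y" "x - y"]
    by (simp add: sum.distrib sum_distrib_left sum_distrib_right power2_eq_square mult_ac)
  also have "\<dots> \<le> (\<Sum>i\<in>Basis. h' (u x) * partial_deriv i (partial_deriv i u) x
      + h'' * (partial_deriv i u x)\<^sup>2)"
    by (rule sum_mono) (rule conjunct2[OF first_second])
  also have "\<dots> = h' (u x) * laplacian u x + h'' * (norm (gradient u x))\<^sup>2"
    by (simp add: laplacian_def power2_norm_gradient sum.distrib sum_distrib_left)
  finally show "2 * real DIM('a) * g' (k x y) + 4 * k x y * g''
      \<le> h' (u x) * laplacian u x + h'' * (norm (gradient u x))\<^sup>2" .
qed

text \<open>A minimizer over the compact set \<open>C\<close> cannot lie outside \<open>U\<close>,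
  where \<open>f\<close> exceeds its value at the competitor \<open>x0\<close>.\<close>

lemma interior_minimum:
  fixes f :: "'a::topological_space \<Rightarrow> real"
  assumes "compact C" "continuous_on C f" "x0 \<in> C" "U \<subseteq> C"
    and "\<And>x. x \<in> C - U \<Longrightarrow> f x0 < f x"
  obtains x where "x \<in> U" "f x \<le> f x0" "\<And>z. z \<in> U \<Longrightarrow> f x \<le> f z"
proof -
  obtain x where x: "x \<in> C" "\<And>z. z \<in> C \<Longrightarrow> f x \<le> f z"
    using continuous_attains_inf[of C f] assms by blast
  show thesis
    by (rule that[of x]) (use x assms in \<open>force+\<close>)
qed

subsection \<open>Supersolutions of the equation without gradient term\<close>

text \<open>The inequality \<open>- \<Delta> v \<ge> e v\<^sup>P\<close> in a viscosity sense, tested only with the functions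
  \<open>z \<mapsto> g (|z - y|\<^sup>2)\<close>, whose Laplacian is \<open>2 N g' + 4 |z - y|\<^sup>2 g''\<close>.\<close>

definition touching_supersolution ::
    "real \<Rightarrow> real \<Rightarrow> 'a::euclidean_space set \<Rightarrow> ('a \<Rightarrow> real) \<Rightarrow> bool" where
  "touching_supersolution e P S v \<longleftrightarrow>
     (\<forall>U x y B g g' g''. open U \<longrightarrow> U \<subseteq> S \<longrightarrow> x \<in> U \<longrightarrow> open B \<longrightarrow> (norm (x - y))\<^sup>2 \<in> B \<longrightarrow>
        (\<forall>r\<in>B. (g has_real_derivative g' r) (at r)) \<longrightarrow>
        (g' has_real_derivative g'') (at ((norm (x - y))\<^sup>2)) \<longrightarrow>
        (\<forall>z\<in>U. v x - g ((norm (x - y))\<^sup>2) \<le> v z - g ((norm (z - y))\<^sup>2)) \<longrightarrow>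
        e * v x powr P
          \<le> - (2 * real DIM('a) * g' ((norm (x - y))\<^sup>2) + 4 * (norm (x - y))\<^sup>2 * g''))"

lemma touching_supersolutionD:
  fixes v :: "'a::euclidean_space \<Rightarrow> real"
  assumes "touching_supersolution e P S v" "open U" "U \<subseteq> S" "x \<in> U"
    and "open B" "(norm (x - y))\<^sup>2 \<in> B" "\<And>r. r \<in> B \<Longrightarrow> (g has_real_derivative g' r) (at r)"
    and "(g' has_real_derivative g'') (at ((norm (x - y))\<^sup>2))"
    and "\<And>z. z \<in> U \<Longrightarrow> v x - g ((norm (x - y))\<^sup>2) \<le> v z - g ((norm (z - y))\<^sup>2)"
  shows "e * v x powr P
    \<le> - (2 * real DIM('a) * g' ((norm (x - y))\<^sup>2) + 4 * (norm (x - y))\<^sup>2 * g'')"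
  using assms(1)[unfolded touching_supersolution_def, rule_format, OF assms(2-8)] assms(9) by blast

text \<open>If \<open>v - g\<close> were negative somewhere, its minimum over a large annulus would
  be interior: the inner sphere is controlled by \<open>boundary\<close>, the outer one by
  positivity of \<open>v\<close> and decay of \<open>g\<close>. Touching there contradicts
  \<open>strict\<close>.\<close>

lemma exterior_comparison:
  fixes v :: "'a::euclidean_space \<Rightarrow> real"
  assumes v: "touching_supersolution e P {x. R < norm x} v" "continuous_on {x. R \<le> norm x} v"
      "\<And>x. R \<le> norm x \<Longrightarrow> 0 < v x"
    and "0 < R"
    and g: "\<And>r. 0 < r \<Longrightarrow> (g has_real_derivative g' r) (at r)"
      "\<And>r. 0 < r \<Longrightarrow> (g' has_real_derivative g'' r) (at r)"
    and boundary: "\<And>x. norm x = R \<Longrightarrow> g (R\<^sup>2) \<le> v x"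
    and lim: "(g \<longlongrightarrow> 0) at_top"
    and strict: "\<And>x. R < norm x \<Longrightarrow>
      - (2 * real DIM('a) * g' ((norm x)\<^sup>2) + 4 * (norm x)\<^sup>2 * g'' ((norm x)\<^sup>2)) < e * v x powr P"
    and x: "R \<le> norm x"
  shows "g ((norm x)\<^sup>2) \<le> v x"
proof (rule ccontr)
  assume neg: "\<not> g ((norm x)\<^sup>2) \<le> v x"
  define f where "f z = v z - g ((norm z)\<^sup>2)" for z
  have "f x < 0" using neg by (simp add: f_def)
  with order_tendstoD(2)[OF lim, of "- f x"] obtain L where L: "\<And>r. L \<le> r \<Longrightarrow> g r < - f x"
    by (auto simp: eventually_at_top_linorder)
  \<comment> \<open>The summand 1 gives \<open>1 \<le> R1\<close>, so that the squared radius
    \<open>R1\<^sup>2\<close> also exceeds \<open>L\<close>.\<close>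
  define R1 where "R1 = norm x + \<bar>L\<bar> + 1"
  have R1: "norm x < R1" "1 \<le> R1" "\<bar>L\<bar> \<le> R1" by (auto simp: R1_def)
  have "L \<le> R1\<^sup>2" using R1 by (smt (verit) self_le_power zero_less_numeral)
  have contg: "continuous_on {0<..} g"
    using g(1) by (intro continuous_at_imp_continuous_on ballI DERIV_isCont) auto
  obtain x1 where x1: "x1 \<in> {z. R < norm z \<and> norm z < R1}"
    "\<And>z. z \<in> {z. R < norm z \<and> norm z < R1} \<Longrightarrow> f x1 \<le> f z"
  proof (rule interior_minimum[of "{z. R \<le> norm z} \<inter> cball 0 R1" f x
        "{z. R < norm z \<and> norm z < R1}"])
    show "compact ({z::'a. R \<le> norm z} \<inter> cball 0 R1)"
      by (intro closed_Int_compact compact_cball closed_Collect_le continuous_intros)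
    have "continuous_on {z::'a. R \<le> norm z} (\<lambda>z. g ((norm z)\<^sup>2))"
      using \<open>0 < R\<close> by (intro continuous_on_compose2[OF contg] continuous_intros) auto
    then show "continuous_on ({z. R \<le> norm z} \<inter> cball 0 R1) f"
      unfolding f_def using v(2) by (intro continuous_intros) (auto elim: continuous_on_subset)
    fix z :: 'a assume z: "z \<in> {z. R \<le> norm z} \<inter> cball 0 R1 - {z. R < norm z \<and> norm z < R1}"
    then consider "norm z = R" | "norm z = R1" by force
    then show "f x < f z"
    proof cases
      case 1
      then show ?thesis using boundary[of z] \<open>f x < 0\<close> by (simp add: f_def)
    next
      case 2
      have "0 < v z" using z v(3) by auto
      moreover have "g (R1\<^sup>2) < - f x" using L \<open>L \<le> R1\<^sup>2\<close> by auto
      ultimately show ?thesis using 2 unfolding f_def[of z] by simp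
    qed
  qed (use x R1 in auto)
  have op: "open {z::'a. R < norm z \<and> norm z < R1}"
    by (intro open_Collect_conj open_Collect_less continuous_intros)
  have "e * v x1 powr P
    \<le> - (2 * real DIM('a) * g' ((norm (x1 - 0))\<^sup>2) + 4 * (norm (x1 - 0))\<^sup>2 * g'' ((norm (x1 - 0))\<^sup>2))"
    by (rule touching_supersolutionD[OF v(1), of "{z::'a. R < norm z \<and> norm z < R1}" _ "{0<..}"])
      (use x1 \<open>0 < R\<close> in \<open>auto intro!: g op simp: f_def\<close>)
  with strict[of x1] x1 show False by simp
qed

text \<open>The power \<open>|x| powr (- 2 * b)\<close> is subharmonic because
  \<open>N - 2 \<le> 2 * b\<close>, and it decays because \<open>0 < b\<close>, so a multiple of it
  fitting below \<open>v\<close> on the inner sphere stays below \<open>v\<close>.\<close>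

lemma power_lower_bound:
  fixes v :: "'a::euclidean_space \<Rightarrow> real"
  assumes v: "touching_supersolution e P {x. R < norm x} v" "continuous_on {x. R \<le> norm x} v"
      "\<And>x. R \<le> norm x \<Longrightarrow> 0 < v x"
    and "0 < R" "0 < e" "0 < b" and b: "real DIM('a) - 2 \<le> 2 * b"
  obtains c where "0 < c" "\<And>x. R \<le> norm x \<Longrightarrow> c * (norm x)\<^sup>2 powr - b \<le> v x"
proof -
  have ne: "sphere (0::'a) R \<noteq> {}"
    using vector_choose_size[of R] \<open>0 < R\<close> by (metis emptyE less_imp_le mem_sphere_0)
  obtain x0 where x0: "x0 \<in> sphere 0 R" "\<And>z. z \<in> sphere 0 R \<Longrightarrow> v x0 \<le> v z"
    using continuous_attains_inf[OF compact_sphere ne continuous_on_subset[OF v(2)]] by force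
  define c where "c = v x0 * R\<^sup>2 powr b"
  have "0 < v x0" using v(3) x0 by simp
  then have "0 < c" using \<open>0 < R\<close> by (simp add: c_def)
  define g where "g r = c * r powr - b" for r
  define g' where "g' r = - (c * b * r powr (- b - 1))" for r
  define g'' where "g'' r = c * b * (b + 1) * r powr (- b - 2)" for r
  have "g ((norm x)\<^sup>2) \<le> v x" if "R \<le> norm x" for x
  proof (rule exterior_comparison[OF v \<open>0 < R\<close> _ _ _ _ _ that, where g = g and g' = g' and g'' = g''])
    fix r :: real assume r: "0 < r"
    show "(g has_real_derivative g' r) (at r)"
      unfolding g_def g'_def using r by (auto intro!: derivative_eq_intros)
    show "(g' has_real_derivative g'' r) (at r)"
      unfolding g'_def g''_def using r
      by (auto intro!: derivative_eq_intros simp: algebra_simps)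
  next
    fix z :: 'a assume "norm z = R"
    then have "v x0 \<le> v z" using x0 by simp
    then show "g (R\<^sup>2) \<le> v z"
      using \<open>0 < R\<close> by (simp add: g_def c_def mult.assoc flip: powr_add)
  next
    show "(g \<longlongrightarrow> 0) at_top"
      unfolding g_def using \<open>0 < b\<close>
      by (intro tendsto_mult_right_zero tendsto_neg_powr filterlim_ident) auto
  next
    fix z :: 'a assume z: "R < norm z"
    define k where "k = (norm z)\<^sup>2"
    have k: "0 < k" using z \<open>0 < R\<close> by (auto simp: k_def)
    have "k * k powr (- b - 2) = k powr (- b - 1)"
      using k powr_add[of k 1 "- b - 2"] by (simp add: minus_diff_commute)
    then have "4 * k * g'' k = 4 * c * b * (b + 1) * k powr (- b - 1)"
      unfolding g''_def by (metis mult.assoc mult.commute)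
    then have "2 * real DIM('a) * g' k + 4 * k * g'' k
        = 2 * c * b * k powr (- b - 1) * (2 * b + 2 - real DIM('a))"
      by (simp add: g'_def algebra_simps)
    also have "\<dots> \<ge> 0" using \<open>0 < b\<close> \<open>0 < c\<close> b by simp
    finally have "- (2 * real DIM('a) * g' k + 4 * k * g'' k) \<le> 0" by linarith
    also have "0 < e * v z powr P" using v(3)[of z] z \<open>0 < e\<close> by simp
    finally show "- (2 * real DIM('a) * g' ((norm z)\<^sup>2) + 4 * (norm z)\<^sup>2 * g'' ((norm z)\<^sup>2))
        < e * v z powr P" by (simp add: k_def)
  qed
  with \<open>0 < c\<close> show thesis by (intro that) (auto simp: g_def)
qed

lemma powr_times_ln_tendsto_0:
  fixes b :: real
  assumes "0 < b"
  shows "((\<lambda>r. r powr - b * ln r) \<longlongrightarrow> 0) at_top"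
proof (rule tendsto_sandwich[where f = "\<lambda>_. 0" and h = "\<lambda>r. 2 / b * r powr - (b / 2)"])
  show "((\<lambda>r. 2 / b * r powr - (b / 2)) \<longlongrightarrow> 0) at_top"
    using assms by (intro tendsto_mult_right_zero tendsto_neg_powr filterlim_ident) auto
  show "\<forall>\<^sub>F r in at_top. 0 \<le> r powr - b * ln r"
    using eventually_ge_at_top[of 1] by eventually_elim auto
  show "\<forall>\<^sub>F r in at_top. r powr - b * ln r \<le> 2 / b * r powr - (b / 2)"
    using eventually_ge_at_top[of 1]
  proof eventually_elim
    case (elim r)
    have "r powr - b * ln r \<le> r powr - b * (r powr (b / 2) / (b / 2))"
      using elim assms by (intro mult_left_mono ln_powr_bound) auto
    also have "\<dots> = 2 / b * (r powr - b * r powr (b / 2))" by simp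
    also have "r powr - b * r powr (b / 2) = r powr - (b / 2)" by (simp flip: powr_add)
    finally show ?case .
  qed
qed auto

text \<open>The power \<open>r powr (- b)\<close> of \<open>r = |x|\<^sup>2\<close> is the scale-invariant decay rate of the inequality,
  for which the logarithmic correction has a Laplacian of the same order as \<open>v powr P\<close>.\<close>

lemma logarithmic_lower_bound:
  fixes v :: "'a::euclidean_space \<Rightarrow> real"
  assumes v: "touching_supersolution e P {x. R < norm x} v" "continuous_on {x. R \<le> norm x} v"
      "\<And>x. R \<le> norm x \<Longrightarrow> 0 < v x"
    and "1 \<le> R" "0 < e" "0 < b" and b: "real DIM('a) - 2 \<le> 2 * b" and P: "P = 1 + 1 / b"
  obtains t where "0 < t" "\<And>x. R \<le> norm x \<Longrightarrow> t * ((norm x)\<^sup>2 powr - b * ln ((norm x)\<^sup>2)) \<le> v x"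
proof -
  have "0 < R" using \<open>1 \<le> R\<close> by simp
  obtain c where "0 < c" and c: "\<And>x. R \<le> norm x \<Longrightarrow> c * (norm x)\<^sup>2 powr - b \<le> v x"
    using power_lower_bound[OF v \<open>0 < R\<close> \<open>0 < e\<close> \<open>0 < b\<close> b] by blast
  \<comment> \<open>The first bound makes the barrier a strict subsolution; its denominator is twice
    \<open>8 * b + 4\<close> so that the inequality is strict. The second puts the barrier below
    \<open>c * R\<^sup>2 powr - b\<close> on the inner sphere, with 1 added to avoid division by
    zero at \<open>R = 1\<close>.\<close>
  define t where "t = min (e * c powr P / (16 * b + 8)) (c / (ln (R\<^sup>2) + 1))"
  have "0 \<le> ln (R\<^sup>2)" using \<open>1 \<le> R\<close> by simp
  have "0 < t" using \<open>0 < e\<close> \<open>0 < c\<close> \<open>0 < b\<close> \<open>0 \<le> ln (R\<^sup>2)\<close> by (auto simp: t_def)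
  have "t \<le> e * c powr P / (16 * b + 8)" by (simp add: t_def)
  then have "t * (16 * b + 8) \<le> e * c powr P"
    using \<open>0 < b\<close> by (subst (asm) pos_le_divide_eq) auto
  moreover have "0 < e * c powr P" using \<open>0 < e\<close> \<open>0 < c\<close> by simp
  ultimately have t1: "t * (8 * b + 4) < e * c powr P" by (simp add: algebra_simps)
  have "t \<le> c / (ln (R\<^sup>2) + 1)" by (simp add: t_def)
  then have "t * (ln (R\<^sup>2) + 1) \<le> c"
    using \<open>0 \<le> ln (R\<^sup>2)\<close> by (subst (asm) pos_le_divide_eq) auto
  then have t2: "t * ln (R\<^sup>2) \<le> c" using \<open>0 < t\<close> by (simp add: algebra_simps)
  define g where "g r = t * (r powr - b * ln r)" for r
  define g' where "g' r = t * (r powr (- b - 1) * (1 - b * ln r))" for r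
  define g'' where "g'' r = t * (r powr (- b - 2) * (- b - (b + 1) * (1 - b * ln r)))" for r
  have "g ((norm x)\<^sup>2) \<le> v x" if "R \<le> norm x" for x
  proof (rule exterior_comparison[OF v \<open>0 < R\<close> _ _ _ _ _ that, where g = g and g' = g' and g'' = g''])
    fix r :: real assume r: "0 < r"
    have shift: "r powr a / r = r powr (a - 1)" for a using r by (simp add: powr_diff)
    show "(g has_real_derivative g' r) (at r)"
      unfolding g_def g'_def using r
      by (auto intro!: derivative_eq_intros simp: algebra_simps shift)
    show "(g' has_real_derivative g'' r) (at r)"
      unfolding g'_def g''_def using r
      by (auto intro!: derivative_eq_intros simp: algebra_simps shift)
  next
    fix z :: 'a assume "norm z = R"
    then have "c * R\<^sup>2 powr - b \<le> v z" using c[of z] by simp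
    moreover have "t * ln (R\<^sup>2) * R\<^sup>2 powr - b \<le> c * R\<^sup>2 powr - b"
      by (intro mult_right_mono t2) simp
    ultimately show "g (R\<^sup>2) \<le> v z" by (simp add: g_def mult_ac)
  next
    show "(g \<longlongrightarrow> 0) at_top"
      unfolding g_def using \<open>0 < b\<close> by (intro tendsto_mult_right_zero powr_times_ln_tendsto_0)
  next
    fix z :: 'a assume z: "R < norm z"
    define k where "k = (norm z)\<^sup>2"
    have k: "1 \<le> k" using z \<open>1 \<le> R\<close> by (auto simp: k_def one_le_power)
    have "k * k powr (- b - 2) = k powr (- b - 1)"
      using k powr_add[of k 1 "- b - 2"] by (simp add: minus_diff_commute)
    then have "4 * k * g'' k = 4 * t * (k powr (- b - 1) * (- b - (b + 1) * (1 - b * ln k)))"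
      by (simp add: g''_def mult_ac)
    \<comment> \<open>The logarithm enters with the factor \<open>2 * b + 2 - N\<close>, nonnegative
      by assumption, and \<open>ln k \<ge> 0\<close>; that part can be discarded, which leaves a
      pure power.\<close>
    then have "- (2 * real DIM('a) * g' k + 4 * k * g'' k) = t * k powr (- b - 1) *
        (8 * b + 4 - (2 * real DIM('a) + 2 * b * (2 * b + 2 - real DIM('a)) * ln k))"
      by (simp add: g'_def algebra_simps)
    also have "\<dots> \<le> t * k powr (- b - 1) * (8 * b + 4)"
    proof (rule mult_left_mono)
      have "0 \<le> 2 * b * (2 * b + 2 - real DIM('a)) * ln k"
        using k \<open>0 < b\<close> b by (intro mult_nonneg_nonneg) auto
      then show "8 * b + 4 - (2 * real DIM('a) + 2 * b * (2 * b + 2 - real DIM('a)) * ln k)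
          \<le> 8 * b + 4" by simp
    qed (use \<open>0 < t\<close> in simp)
    also have "\<dots> = t * (8 * b + 4) * k powr (- b - 1)" by simp
    also have "\<dots> < e * c powr P * k powr (- b - 1)"
      using t1 k by (intro mult_strict_right_mono) auto
    \<comment> \<open>Here the choice of \<open>P\<close> enters: \<open>b * P = b + 1\<close>, so
      the nonlinearity applied to the first lower bound has exactly the decay of the Laplacian of
      the barrier.\<close>
    also have "\<dots> = e * (c * k powr - b) powr P"
      using \<open>0 < c\<close> \<open>0 < b\<close> by (simp add: powr_mult powr_powr P algebra_simps minus_diff_commute)
    also have "\<dots> \<le> e * v z powr P"
      using c[of z] z \<open>0 < e\<close> \<open>0 < c\<close> \<open>0 < b\<close>
      by (intro mult_left_mono powr_mono2) (auto simp: k_def P)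
    finally show "- (2 * real DIM('a) * g' ((norm z)\<^sup>2) + 4 * (norm z)\<^sup>2 * g'' ((norm z)\<^sup>2))
        < e * v z powr P" by (simp add: k_def)
  qed
  with \<open>0 < t\<close> show thesis by (intro that) (auto simp: g_def)
qed

text \<open>Where \<open>\<phi> / v\<close> is maximal, a multiple of \<open>\<phi>\<close> touches
  \<open>v\<close> from below, and the Laplacian of \<open>\<phi>\<close> limits \<open>v\<close> at
  that point.\<close>

lemma ball_upper_bound:
  fixes v :: "'a::euclidean_space \<Rightarrow> real"
  assumes v: "touching_supersolution e P (ball y r) v" "continuous_on (cball y r) v"
      "\<And>x. x \<in> cball y r \<Longrightarrow> 0 < v x"
    and "0 < r" "0 < e"
  obtains x where "x \<in> ball y r"
    "e * v x powr (P - 1) * r\<^sup>2 \<le> real DIM('a) * (real DIM('a) + 2)\<^sup>2"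
proof -
  \<comment> \<open>The outer square matters: with \<open>d = r\<^sup>2 - |x - y|\<^sup>2\<close>,
    minus the Laplacian of \<open>\<phi>\<close> is \<open>(4 * N + 8) * d - 8 * r\<^sup>2\<close>,
    which is negative near the sphere. This keeps the touching point away from it.\<close>
  define \<phi> where "\<phi> z = (r\<^sup>2 - (norm (z - y))\<^sup>2)\<^sup>2" for z
  obtain x where x: "x \<in> ball y r" "\<And>z. z \<in> ball y r \<Longrightarrow> - (\<phi> x / v x) \<le> - (\<phi> z / v z)"
  proof (rule interior_minimum[of "cball y r" "\<lambda>z. - (\<phi> z / v z)" y "ball y r"])
    show "continuous_on (cball y r) (\<lambda>z. - (\<phi> z / v z))"
      unfolding \<phi>_def using v(3) by (intro continuous_intros v(2)) force
    fix z assume "z \<in> cball y r - ball y r"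
    then have "norm (z - y) = r" by (auto simp: dist_norm norm_minus_commute)
    then show "- (\<phi> y / v y) < - (\<phi> z / v z)"
      using \<open>0 < r\<close> v(3)[of y] by (simp add: \<phi>_def)
  qed (use \<open>0 < r\<close> in auto)
  define d where "d = r\<^sup>2 - (norm (x - y))\<^sup>2"
  have "norm (x - y) < r" using x(1) by (simp add: dist_norm norm_minus_commute)
  then have d: "0 < d" "d \<le> r\<^sup>2" by (auto simp: d_def power_strict_mono)
  define T where "T = v x / \<phi> x"
  have w: "0 < v x" using v(3)[of x] x by simp
  have \<phi>x: "\<phi> x = d\<^sup>2" by (simp add: \<phi>_def d_def)
  have "0 < T" using d w by (simp add: T_def \<phi>x)
  have below: "T * \<phi> z \<le> v z" if "z \<in> ball y r" for z
    using x(2)[OF that] v(3)[of z] that w d by (simp add: T_def \<phi>x field_simps)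
  have touch: "v x = T * \<phi> x" using d by (simp add: T_def \<phi>x)
  have "e * v x powr P \<le> - (2 * real DIM('a) * (- (2 * T * (r\<^sup>2 - (norm (x - y))\<^sup>2)))
      + 4 * (norm (x - y))\<^sup>2 * (2 * T))"
  proof (rule touching_supersolutionD[OF v(1) open_ball order_refl x(1) open_UNIV,
        where g = "\<lambda>k. T * (r\<^sup>2 - k)\<^sup>2" and g' = "\<lambda>k. - (2 * T * (r\<^sup>2 - k))"])
    fix z assume "z \<in> ball y r"
    then show "v x - T * (r\<^sup>2 - (norm (x - y))\<^sup>2)\<^sup>2 \<le> v z - T * (r\<^sup>2 - (norm (z - y))\<^sup>2)\<^sup>2"
      using touch below by (simp add: \<phi>_def)
  qed (auto intro!: derivative_eq_intros simp: algebra_simps)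
  also have "\<dots> = T * ((4 * real DIM('a) + 8) * d - 8 * r\<^sup>2)"
    by (simp add: d_def algebra_simps)
  finally have main: "e * v x powr P \<le> T * ((4 * real DIM('a) + 8) * d - 8 * r\<^sup>2)" .
  \<comment> \<open>Splitting off one factor \<open>v x = T * d\<^sup>2\<close> lets the unknown
    multiple \<open>T\<close> cancel.\<close>
  have "v x powr P = T * (v x powr (P - 1) * d\<^sup>2)"
    using w touch by (simp add: powr_diff \<phi>x)
  with main have "T * (e * v x powr (P - 1) * d\<^sup>2) \<le> T * ((4 * real DIM('a) + 8) * d - 8 * r\<^sup>2)"
    by (simp add: mult_ac)
  then have main: "e * v x powr (P - 1) * d\<^sup>2 \<le> (4 * real DIM('a) + 8) * d - 8 * r\<^sup>2"
    using \<open>0 < T\<close> by simp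
  define n where "n = real DIM('a)"
  define a where "a = e * v x powr (P - 1)"
  have "0 < a" using \<open>0 < e\<close> w by (simp add: a_def)
  have main: "a * d\<^sup>2 \<le> (4 * n + 8) * d - 8 * r\<^sup>2" using main by (simp add: a_def n_def)
  have "0 \<le> n" by (simp add: n_def)
  have "0 \<le> (4 * n + 8) * d - 8 * r\<^sup>2" using main \<open>0 < a\<close> by (smt (verit) mult_nonneg_nonneg zero_le_power2)
  then have low: "2 * r\<^sup>2 \<le> (n + 2) * d" by (simp add: algebra_simps)
  have "(4 * n + 8) * d \<le> (4 * n + 8) * r\<^sup>2" using d \<open>0 \<le> n\<close> by (intro mult_left_mono) auto
  with main have up: "a * d\<^sup>2 \<le> 4 * n * r\<^sup>2" by (simp add: algebra_simps)
  have "(2 * r\<^sup>2)\<^sup>2 \<le> ((n + 2) * d)\<^sup>2" using low by (intro power_mono) auto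
  then have "a * (2 * r\<^sup>2)\<^sup>2 \<le> a * ((n + 2) * d)\<^sup>2" using \<open>0 < a\<close> by simp
  also have "\<dots> = (n + 2)\<^sup>2 * (a * d\<^sup>2)" by (simp add: power_mult_distrib)
  also have "\<dots> \<le> (n + 2)\<^sup>2 * (4 * n * r\<^sup>2)" using up by (intro mult_left_mono) auto
  finally have "(4 * r\<^sup>2) * (a * r\<^sup>2) \<le> (4 * r\<^sup>2) * (n * (n + 2)\<^sup>2)"
    by (simp add: power_mult_distrib power2_eq_square mult_ac)
  then have "a * r\<^sup>2 \<le> n * (n + 2)\<^sup>2" using \<open>0 < r\<close> by simp
  with x(1) show thesis by (intro that[of x]) (auto simp: a_def n_def)
qed

lemma touching_supersolution_subset:
  "touching_supersolution e P S v \<Longrightarrow> T \<subseteq> S \<Longrightarrow> touching_supersolution e P T v"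
  unfolding touching_supersolution_def by (meson subset_trans)

text \<open>On a ball of radius \<open>r\<close> about a point at distance \<open>2 * r\<close>, the
  upper bound limits \<open>v powr (P - 1) * r\<^sup>2\<close> at some point, whereas the logarithm
  makes this quantity exceed any constant as \<open>r\<close> grows.\<close>

lemma no_positive_touching_supersolution:
  fixes v :: "'a::euclidean_space \<Rightarrow> real"
  assumes v: "touching_supersolution e P {x. R < norm x} v" "continuous_on {x. R \<le> norm x} v"
      "\<And>x. R \<le> norm x \<Longrightarrow> 0 < v x"
    and "1 \<le> R" "0 < e" "0 < b" and b: "real DIM('a) - 2 \<le> 2 * b" and P: "P = 1 + 1 / b"
  shows False
proof -
  obtain t where "0 < t" and t: "\<And>x. R \<le> norm x \<Longrightarrow> t * ((norm x)\<^sup>2 powr - b * ln ((norm x)\<^sup>2)) \<le> v x"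
    using logarithmic_lower_bound[OF assms] by blast
  \<comment> \<open>The factor 9 pays for replacing \<open>r\<^sup>2\<close> by
    \<open>(norm x)\<^sup>2\<close>, as \<open>norm x \<le> 3 * r\<close> in the ball.\<close>
  define C where "C = 9 * (real DIM('a) * (real DIM('a) + 2)\<^sup>2)"
  have "0 \<le> C" by (simp add: C_def)
  \<comment> \<open>Solves \<open>e * (t * L) powr (1 / b) = C + 1\<close>; once \<open>ln k\<close>
    reaches \<open>L\<close>, the lower bound for \<open>e * v x powr (P - 1) * k\<close> exceeds
    \<open>C\<close>.\<close>
  define L where "L = ((C + 1) / e) powr b / t"
  have "0 < L" using \<open>0 \<le> C\<close> \<open>0 < e\<close> \<open>0 < t\<close> by (simp add: L_def)
  define r where "r = R + exp L"
  have r: "R < r" "1 < r" using \<open>1 \<le> R\<close> by (auto simp: r_def intro: add_le_less_mono[of 1 R 0 "exp L", simplified])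
  have "L \<le> ln (r\<^sup>2)"
  proof -
    have "L = ln (exp L)" by simp
    also have "\<dots> \<le> ln r" using \<open>1 \<le> R\<close> by (subst ln_le_cancel_iff) (auto simp: r_def add_pos_pos)
    also have "\<dots> \<le> ln (r\<^sup>2)" using r by (simp add: ln_realpow)
    finally show ?thesis .
  qed
  obtain y :: 'a where y: "norm y = 2 * r" using vector_choose_size[of "2 * r"] r by auto
  have away: "r \<le> norm z \<and> norm z \<le> 3 * r" if "z \<in> cball y r" for z
    using that norm_triangle_ineq2[of y z] norm_triangle_ineq2[of z y] y
    by (auto simp: dist_norm norm_minus_commute)
  have sub: "cball y r \<subseteq> {x. R < norm x}"
    by (intro subsetI CollectI less_le_trans[OF r(1) conjunct1[OF away]])
  obtain x where x: "x \<in> ball y r"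
    "e * v x powr (P - 1) * r\<^sup>2 \<le> real DIM('a) * (real DIM('a) + 2)\<^sup>2"
  proof (rule ball_upper_bound[of e P y r v])
    show "touching_supersolution e P (ball y r) v"
      by (rule touching_supersolution_subset[OF v(1) subset_trans[OF ball_subset_cball sub]])
    show "continuous_on (cball y r) v"
      using sub by (intro continuous_on_subset[OF v(2)]) force
    show "0 < v z" if "z \<in> cball y r" for z
      using away[OF that] r v(3)[of z] by auto
  qed (use r \<open>0 < e\<close> in auto)
  define k where "k = (norm x)\<^sup>2"
  have xr: "r \<le> norm x" "norm x \<le> 3 * r" using away[of x] x(1) by auto
  have k: "r\<^sup>2 \<le> k" "k \<le> 9 * r\<^sup>2"
    using power_mono[OF xr(1), of 2] power_mono[OF xr(2), of 2] r by (auto simp: k_def power_mult_distrib)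
  have "0 < k" using k(1) r by (smt (verit) zero_less_power)
  have "L \<le> ln k" using \<open>L \<le> ln (r\<^sup>2)\<close> k(1) r by (smt (verit) ln_mono zero_less_power)
  have "((C + 1) / e) powr b * k powr - b = t * (k powr - b * L)"
    using \<open>0 < t\<close> by (simp add: L_def)
  also have "\<dots> \<le> t * (k powr - b * ln k)"
    using \<open>0 < t\<close> \<open>L \<le> ln k\<close> by (intro mult_left_mono) auto
  also have "\<dots> \<le> v x" using t[of x] xr r by (simp add: k_def)
  finally have "(((C + 1) / e) powr b * k powr - b) powr (1 / b) \<le> v x powr (1 / b)"
    using \<open>0 < b\<close> by (intro powr_mono2) auto
  moreover have "(((C + 1) / e) powr b * k powr - b) powr (1 / b) = (C + 1) / e / k"
    using \<open>0 < b\<close> \<open>0 < k\<close> \<open>0 \<le> C\<close> \<open>0 < e\<close>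
    by (subst powr_mult) (simp_all add: powr_powr powr_neg_one)
  ultimately have "(C + 1) / e / k \<le> v x powr (P - 1)" by (simp add: P)
  then have "C + 1 \<le> e * v x powr (P - 1) * k"
    using \<open>0 < e\<close> \<open>0 < k\<close> by (simp add: field_simps)
  also have "\<dots> \<le> e * v x powr (P - 1) * (9 * r\<^sup>2)"
    using k \<open>0 < e\<close> by (intro mult_left_mono) auto
  also have "\<dots> \<le> C" using x(2) by (simp add: C_def)
  finally show False by simp
qed

subsection \<open>Removal of the gradient term\<close>

text \<open>The second derivative of \<open>r powr s\<close> produces a term
  \<open>- s * (1 - s) * u powr (s - 2) * |\<nabla>u|\<^sup>2\<close>, which cancels the gradient
  term allowed in \<open>super\<close>.\<close>

lemma power_touching_supersolution:
  fixes u :: "'a::euclidean_space \<Rightarrow> real"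
  assumes C2: "C2_on S u" and "0 < s"
    and pos: "\<And>x. x \<in> S \<Longrightarrow> 0 < u x"
    and super: "\<And>x. x \<in> S \<Longrightarrow>
      e * u x powr p - (1 - s) * ((norm (gradient u x))\<^sup>2 / u x) \<le> - laplacian u x"
  shows "touching_supersolution (s * e) ((p + s - 1) / s) S (\<lambda>x. u x powr s)"
  unfolding touching_supersolution_def
proof (intro allI impI)
  fix U and x y :: 'a and B g g' g''
  assume U: "open U" "U \<subseteq> S" "x \<in> U" and B: "open B" "(norm (x - y))\<^sup>2 \<in> B"
    and g: "\<forall>r\<in>B. (g has_real_derivative g' r) (at r)"
      "(g' has_real_derivative g'') (at ((norm (x - y))\<^sup>2))"
    and min: "\<forall>z\<in>U. u x powr s - g ((norm (x - y))\<^sup>2) \<le> u z powr s - g ((norm (z - y))\<^sup>2)"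
  have "0 < u x" using pos U by auto
  define w where "w = u x"
  define G where "G = (norm (gradient u x))\<^sup>2"
  have "0 < w" using \<open>0 < u x\<close> by (simp add: w_def)
  have "2 * real DIM('a) * g' ((norm (x - y))\<^sup>2) + 4 * (norm (x - y))\<^sup>2 * g''
      \<le> s * u x powr (s - 1) * laplacian u x
        + s * (s - 1) * u x powr (s - 2) * (norm (gradient u x))\<^sup>2"
  proof (rule touching_radial(2)[OF C2_on_subset[OF C2 U(2)] U(1,3), where A = "{0<..}"
        and h = "\<lambda>r. r powr s" and h' = "\<lambda>r. s * r powr (s - 1)" and B = B and g = g])
    fix r :: real assume "r \<in> {0<..}"
    then show "((\<lambda>r. r powr s) has_real_derivative s * r powr (s - 1)) (at r)"
      by (auto intro!: derivative_eq_intros)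
  next
    show "((\<lambda>r. s * r powr (s - 1)) has_real_derivative s * (s - 1) * u x powr (s - 2)) (at (u x))"
      using \<open>0 < u x\<close> by (auto intro!: derivative_eq_intros simp: algebra_simps)
  qed (use B g min \<open>0 < u x\<close> in auto)
  also have "\<dots> \<le> s * u x powr (s - 1) * (- (e * u x powr p) + (1 - s) * ((norm (gradient u x))\<^sup>2 / u x))
        + s * (s - 1) * u x powr (s - 2) * (norm (gradient u x))\<^sup>2"
    using super[of x] U \<open>0 < s\<close> by (intro add_right_mono mult_left_mono) auto
  also have "\<dots> = - (s * e * (w powr (s - 1) * w powr p))
      + s * (1 - s) * G * (w powr (s - 1) / w - w powr (s - 2))"
    by (simp add: algebra_simps diff_divide_distrib w_def G_def)
  also have "w powr (s - 1) / w = w powr (s - 2)"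
    using \<open>0 < w\<close> powr_diff[of w "s - 1" 1] by simp
  also have "w powr (s - 1) * w powr p = (w powr s) powr ((p + s - 1) / s)"
    using \<open>0 < s\<close> by (simp add: powr_powr add.commute add_diff_eq flip: powr_add)
  finally show "s * e * (u x powr s) powr ((p + s - 1) / s)
      \<le> - (2 * real DIM('a) * g' ((norm (x - y))\<^sup>2) + 4 * (norm (x - y))\<^sup>2 * g'')"
    by (simp add: w_def)
qed

text \<open>Weighted Young with exponent \<open>p / (p + 1)\<close> splits \<open>G powr q\<close>
  into \<open>w powr p\<close> and \<open>G\<^sup>2 / w\<close>. The strict bound on
  \<open>M\<close> leaves room both for \<open>c \<le> C\<close> and for a positive remainder
  \<open>e\<close>.\<close>

lemma gradient_term_absorption:
  fixes p q M C :: real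
  assumes "1 < p" "0 \<le> C" "C \<le> 1" and q: "q = 2 * p / (p + 1)"
    and M: "- ((p + 1) * (C / p) powr (p / (p + 1))) < M"
  obtains c e where "0 \<le> c" "c < 1" "c \<le> C" "0 < e"
    "\<And>w G. 0 < w \<Longrightarrow> 0 \<le> G \<Longrightarrow> e * w powr p - c * (G\<^sup>2 / w) \<le> w powr p + M * G powr q"
proof (cases "0 \<le> M")
  \<comment> \<open>This covers \<open>C = 0\<close>, where \<open>0 powr (p / (p + 1)) = 0\<close>
    turns the hypothesis into \<open>0 < M\<close>.\<close>
  case True
  then show thesis using \<open>0 \<le> C\<close> by (intro that[of 0 1]) auto
next
  case False
  define \<alpha> where "\<alpha> = p / (p + 1)"
  have \<alpha>: "0 < \<alpha>" "q = 2 * \<alpha>" "1 / (p + 1) = 1 - \<alpha>"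
    using \<open>1 < p\<close> by (auto simp: \<alpha>_def q field_simps)
  define \<mu> where "\<mu> = (p + 1) * (C / p) powr \<alpha>"
  define m where "m = (\<mu> - M) / 2"
  have m: "- M < m" "m < \<mu>" "0 < m" using M False by (auto simp: m_def \<mu>_def \<alpha>_def)
  \<comment> \<open>The inverse of the threshold formula:
    \<open>(p + 1) * (c / p) powr \<alpha> = m\<close>, so \<open>m < \<mu>\<close> becomes
    \<open>c < C\<close>.\<close>
  define c where "c = p * (m / (p + 1)) powr (1 / \<alpha>)"
  have "0 < c" using m \<open>1 < p\<close> by (simp add: c_def)
  have "m / (p + 1) < (C / p) powr \<alpha>"
    using m(2) \<open>1 < p\<close> by (simp add: \<mu>_def pos_divide_less_eq mult.commute)
  then have "(m / (p + 1)) powr (1 / \<alpha>) < ((C / p) powr \<alpha>) powr (1 / \<alpha>)"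
    using m \<open>1 < p\<close> \<alpha>(1) by (intro powr_less_mono2) auto
  also have "\<dots> = C / p" using \<alpha>(1) \<open>0 \<le> C\<close> \<open>1 < p\<close> by (simp add: powr_powr)
  finally have "c < C" using \<open>1 < p\<close> by (simp add: c_def pos_less_divide_eq mult.commute)
  have mc: "(p + 1) * (c / p) powr \<alpha> = m"
    using \<alpha>(1) m \<open>1 < p\<close> by (simp add: c_def powr_powr)
  have young: "m * G powr q \<le> w powr p + c * (G\<^sup>2 / w)" if "0 < w" "0 \<le> G" for w G
  proof (cases "G = 0")
    case True
    then show ?thesis by simp
  next
    case False
    with that have "0 < G" by simp
    \<comment> \<open>The scaling of \<open>a\<close> and \<open>b\<close> makes the weighted sum
      equal to the right-hand side; in the product the powers of \<open>w\<close> cancel because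
      \<open>p * (1 - \<alpha>) = \<alpha>\<close>.\<close>
    define a where "a = (p + 1) * (c / p) * (G\<^sup>2 / w)"
    define b where "b = (p + 1) * w powr p"
    have "a powr \<alpha> * b powr (1 - \<alpha>) \<le> \<alpha> * a + (1 - \<alpha>) * b"
      using \<alpha> \<open>0 < c\<close> \<open>1 < p\<close> \<open>0 < G\<close> \<open>0 < w\<close>
      by (intro Youngs_inequality_0) (auto simp: a_def b_def \<alpha>_def)
    moreover have "\<alpha> * a = c * (G\<^sup>2 / w)"
      using \<open>1 < p\<close> by (simp add: \<alpha>_def a_def)
    moreover have "(1 - \<alpha>) * b = w powr p"
      using \<open>1 < p\<close> by (simp add: b_def flip: \<alpha>(3))
    moreover have "a powr \<alpha> * b powr (1 - \<alpha>) = m * G powr q"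
    proof -
      have p\<alpha>: "p * (1 - \<alpha>) = \<alpha>" using \<open>1 < p\<close> by (simp add: \<alpha>_def field_simps)
      have "(G\<^sup>2) powr \<alpha> = G powr q"
        using \<open>0 < G\<close> \<alpha>(2) by (simp add: powr_powr flip: powr_numeral)
      then have A: "a powr \<alpha> = (p + 1) powr \<alpha> * (c / p) powr \<alpha> * (G powr q / w powr \<alpha>)"
        using \<open>1 < p\<close> \<open>0 < c\<close> \<open>0 < G\<close> \<open>0 < w\<close> by (simp add: a_def powr_mult powr_divide)
      have B: "b powr (1 - \<alpha>) = (p + 1) powr (1 - \<alpha>) * w powr \<alpha>"
        using \<open>1 < p\<close> \<open>0 < w\<close> by (simp add: b_def powr_mult powr_powr p\<alpha>)
      have "(p + 1) powr \<alpha> * (p + 1) powr (1 - \<alpha>) = p + 1"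
        using \<open>1 < p\<close> by (simp flip: powr_add)
      moreover have "a powr \<alpha> * b powr (1 - \<alpha>)
          = (p + 1) powr \<alpha> * (p + 1) powr (1 - \<alpha>) * (c / p) powr \<alpha> * G powr q"
        unfolding A B using \<open>0 < w\<close> by simp
      ultimately show ?thesis using mc by simp
    qed
    ultimately show ?thesis by simp
  qed
  \<comment> \<open>Only the fraction \<open>\<theta> < 1\<close> of Young's inequality is used,
    which leaves \<open>(1 - \<theta>) * w powr p\<close>.\<close>
  define \<theta> where "\<theta> = - M / m"
  have \<theta>: "0 < \<theta>" "\<theta> < 1" "M = - \<theta> * m" using m False by (auto simp: \<theta>_def field_simps)
  show thesis
  proof (rule that[of c "1 - \<theta>"])
    fix w G :: real assume w: "0 < w" "0 \<le> G"
    have "\<theta> * (m * G powr q) \<le> \<theta> * (w powr p + c * (G\<^sup>2 / w))"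
      using young[OF w] \<theta> by (intro mult_left_mono) auto
    moreover have "\<theta> * (c * (G\<^sup>2 / w)) \<le> c * (G\<^sup>2 / w)"
      using \<theta> \<open>0 < c\<close> w by (intro mult_left_le_one_le) auto
    then have "\<theta> * (w powr p + c * (G\<^sup>2 / w)) \<le> \<theta> * w powr p + c * (G\<^sup>2 / w)"
      by (simp add: distrib_left)
    ultimately show "(1 - \<theta>) * w powr p - c * (G\<^sup>2 / w) \<le> w powr p + M * G powr q"
      by (simp add: \<theta>(3) algebra_simps)
  qed (use \<theta> \<open>0 < c\<close> \<open>c < C\<close> \<open>C \<le> 1\<close> in auto)
qed

subsection \<open>Strong maximum principle\<close>

text \<open>Comparison with a small multiple \<open>\<delta>\<close> of a strictly subharmonic barrier: since \<open>q > 1\<close>, the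
  gradient term is of higher order in \<open>\<delta>\<close>.\<close>

lemma positivity_in_ball:
  fixes u :: "'a::euclidean_space \<Rightarrow> real"
  assumes C2: "C2_on S u" and sub: "cball y R \<subseteq> S" and "1 < q"
    and nonneg: "\<And>x. x \<in> S \<Longrightarrow> 0 \<le> u x"
    and super: "\<And>x. x \<in> S \<Longrightarrow> M * norm (gradient u x) powr q \<le> - laplacian u x"
    and "0 < u y" and x: "x \<in> ball y R"
  shows "0 < u x"
proof (rule ccontr)
  assume "\<not> 0 < u x"
  have "0 < R" using x by (metis ball_eq_empty empty_iff not_le)
  have cont: "continuous_on (cball y R) u"
    using continuous_on_subset[OF C2_on_imp_continuous_on[OF C2] sub] .
  then have "isCont u y"
    using continuous_on_interior[of "cball y R" u y] \<open>0 < R\<close> by simp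
  then obtain d where d: "0 < d" "\<And>z. dist z y < d \<Longrightarrow> dist (u z) (u y) < u y / 2"
    unfolding continuous_at_eps_delta using \<open>0 < u y\<close> by (meson half_gt_zero)
  define \<rho> where "\<rho> = min d R / 2"
  define m where "m = u y / 2"
  have \<rho>: "0 < \<rho>" "\<rho> < R" using d(1) \<open>0 < R\<close> by (auto simp: \<rho>_def)
  have "0 < m" using \<open>0 < u y\<close> by (simp add: m_def)
  have m: "m \<le> u z" if "norm (z - y) \<le> \<rho>" for z
  proof -
    have "\<bar>u z - u y\<bar> < u y / 2"
      using d(2)[of z] that d(1) \<open>0 < R\<close> by (simp add: \<rho>_def dist_norm dist_real_def)
    then show ?thesis unfolding m_def by linarith
  qed
  define n where "n = real DIM('a)"
  have "1 \<le> n" by (simp add: n_def DIM_positive Suc_leI)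
  \<comment> \<open>On the annulus between radii \<open>\<rho>\<close> and \<open>R\<close>,
    \<open>\<delta> * D\<close> bounds the gradient of the barrier from above and
    \<open>\<delta> * A\<close> its Laplacian from below. The 1 in \<open>E\<close> keeps it
    positive and makes the later comparison with \<open>A\<close> strict.\<close>
  define D where "D = 2 * n * (\<rho>\<^sup>2) powr (- n - 1) * R"
  define A where "A = (2 * n\<^sup>2 + 4 * n) * (R\<^sup>2) powr (- n - 1)"
  define E where "E = \<bar>M\<bar> * D powr q + 1"
  have "0 < D" using \<open>1 \<le> n\<close> \<rho> \<open>0 < R\<close> by (simp add: D_def)
  have "0 < A" using \<open>1 \<le> n\<close> \<open>0 < R\<close> by (simp add: A_def add_pos_pos)
  have "0 < E" by (simp add: E_def add_nonneg_pos)
  \<comment> \<open>The first bound keeps the barrier below \<open>m\<close> on the inner sphere;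
    the second makes \<open>|M| * (\<delta> * D) powr q < \<delta> * A\<close>, using
    \<open>q > 1\<close>.\<close>
  define \<delta> where "\<delta> = min (m * (\<rho>\<^sup>2) powr n) ((A / E) powr (1 / (q - 1)))"
  have "0 < \<delta>" using \<open>0 < m\<close> \<rho> \<open>0 < A\<close> \<open>0 < E\<close> by (simp add: \<delta>_def)
  have "\<delta> powr (q - 1) \<le> ((A / E) powr (1 / (q - 1))) powr (q - 1)"
    using \<open>0 < \<delta>\<close> \<open>1 < q\<close> by (intro powr_mono2) (auto simp: \<delta>_def)
  also have "\<dots> = A / E" using \<open>0 < A\<close> \<open>0 < E\<close> \<open>1 < q\<close> by (simp add: powr_powr)
  finally have "\<delta> powr (q - 1) * E \<le> A" using \<open>0 < E\<close> by (simp add: pos_le_divide_eq)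
  then have "\<delta> powr (q - 1) * (\<bar>M\<bar> * D powr q) + \<delta> powr (q - 1) \<le> A"
    by (simp add: E_def distrib_left)
  moreover have "0 < \<delta> powr (q - 1)" using \<open>0 < \<delta>\<close> by simp
  ultimately have \<delta>: "\<delta> powr (q - 1) * (\<bar>M\<bar> * D powr q) < A" by linarith
  \<comment> \<open>The barrier \<open>|z - y| powr (- 2 * n)\<close>, shifted to vanish on the
    outer sphere, has the positive Laplacian
    \<open>\<delta> * (2 * n\<^sup>2 + 4 * n) * k powr (- n - 1)\<close> with
    \<open>k = |z - y|\<^sup>2\<close>.\<close>
  define g where "g r = \<delta> * (r powr - n - (R\<^sup>2) powr - n)" for r
  define g' where "g' r = - (\<delta> * n * r powr (- n - 1))" for r
  define g'' where "g'' r = \<delta> * n * (n + 1) * r powr (- n - 2)" for r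
  have dg: "(g has_real_derivative g' r) (at r)" if "0 < r" for r
    unfolding g_def g'_def using that by (auto intro!: derivative_eq_intros)
  have dg': "(g' has_real_derivative g'' r) (at r)" if "0 < r" for r
    unfolding g'_def g''_def using that by (auto intro!: derivative_eq_intros simp: algebra_simps)
  define f where "f z = u z - g ((norm (z - y))\<^sup>2)" for z
  define V where "V = {z. \<rho> < norm (z - y) \<and> norm (z - y) < R}"
  have "open V"
    unfolding V_def by (intro open_Collect_conj open_Collect_less continuous_intros)
  have xV: "\<rho> < norm (x - y)" "norm (x - y) < R"
    using m[of x] \<open>\<not> 0 < u x\<close> \<open>0 < m\<close> x by (auto simp: dist_norm norm_minus_commute not_le[symmetric])
  have "(R\<^sup>2) powr - n < ((norm (x - y))\<^sup>2) powr - n"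
    using xV \<rho> \<open>1 \<le> n\<close> by (intro powr_less_mono2_neg) (auto simp: power_strict_mono)
  then have "0 < g ((norm (x - y))\<^sup>2)" using \<open>0 < \<delta>\<close> by (simp add: g_def)
  then have fx: "f x < 0" using \<open>\<not> 0 < u x\<close> by (simp add: f_def)
  obtain z where z: "z \<in> V" "\<And>z'. z' \<in> V \<Longrightarrow> f z \<le> f z'"
  proof (rule interior_minimum[of "{z. \<rho> \<le> norm (z - y)} \<inter> cball y R" f x V])
    show "compact ({z. \<rho> \<le> norm (z - y)} \<inter> cball y R)"
      by (intro closed_Int_compact compact_cball closed_Collect_le continuous_intros)
    have "continuous_on {0<..} g"
      using dg by (intro continuous_at_imp_continuous_on ballI DERIV_isCont) auto
    then have "continuous_on {z. \<rho> \<le> norm (z - y)} (\<lambda>z. g ((norm (z - y))\<^sup>2))"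
      using \<rho> by (elim continuous_on_compose2) (auto intro!: continuous_intros)
    then show "continuous_on ({z. \<rho> \<le> norm (z - y)} \<inter> cball y R) f"
      unfolding f_def using cont by (intro continuous_intros) (auto elim: continuous_on_subset)
    fix z assume zz: "z \<in> {z. \<rho> \<le> norm (z - y)} \<inter> cball y R - V"
    then consider "norm (z - y) = \<rho>" | "norm (z - y) = R"
      by (force simp: V_def dist_norm norm_minus_commute)
    then have "0 \<le> f z"
    proof cases
      case 1
      have "g (\<rho>\<^sup>2) \<le> \<delta> * (\<rho>\<^sup>2) powr - n"
        using \<open>0 < \<delta>\<close> by (simp add: g_def algebra_simps)
      also have "\<dots> \<le> m * (\<rho>\<^sup>2) powr n * (\<rho>\<^sup>2) powr - n"
        by (intro mult_right_mono) (auto simp: \<delta>_def)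
      also have "\<dots> = m" using \<rho> by (simp add: mult.assoc flip: powr_add)
      finally show ?thesis using m[of z] 1 by (simp add: f_def)
    next
      case 2
      then show ?thesis using nonneg[of z] zz sub by (auto simp: f_def g_def)
    qed
    with fx show "f x < f z" by simp
  qed (use xV in \<open>auto simp: V_def dist_norm norm_minus_commute\<close>)
  have "V \<subseteq> S" using sub by (auto simp: V_def dist_norm norm_minus_commute)
  define \<kappa> where "\<kappa> = norm (z - y)"
  define k where "k = \<kappa>\<^sup>2"
  have \<kappa>: "\<rho> < \<kappa>" "\<kappa> < R" using z(1) by (auto simp: V_def \<kappa>_def)
  have k: "0 < k" "\<rho>\<^sup>2 \<le> k" "k \<le> R\<^sup>2" using \<kappa> \<rho> by (auto simp: k_def power_mono)
  have min: "u z - g ((norm (z - y))\<^sup>2) \<le> u z' - g ((norm (z' - y))\<^sup>2)" if "z' \<in> V" for z'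
    using z(2)[OF that] by (simp add: f_def)
  note touch = touching_radial[OF C2_on_subset[OF C2 \<open>V \<subseteq> S\<close>] \<open>open V\<close> z(1) open_UNIV UNIV_I,
      where h = "\<lambda>r. r" and h' = "\<lambda>_. 1" and h'' = 0 and B = "{0<..}" and g = g and g' = g'
        and g'' = "g'' k" and y = y]
  have "1 *\<^sub>R gradient u z = (2 * g' ((norm (z - y))\<^sup>2)) *\<^sub>R (z - y)"
    by (rule touch(1)) (use k dg dg' min in \<open>auto simp: k_def \<kappa>_def\<close>)
  then have "norm (gradient u z) = \<bar>2 * g' k\<bar> * \<kappa>" by (simp add: k_def \<kappa>_def)
  also have "\<bar>2 * g' k\<bar> = 2 * (\<delta> * n * k powr (- n - 1))"
    using \<open>0 < \<delta>\<close> \<open>1 \<le> n\<close> by (simp add: g'_def abs_mult)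
  also have "2 * (\<delta> * n * k powr (- n - 1)) * \<kappa> = \<delta> * (2 * n * k powr (- n - 1) * \<kappa>)" by simp
  also have "\<dots> \<le> \<delta> * D"
    unfolding D_def using \<open>0 < \<delta>\<close> \<open>1 \<le> n\<close> \<kappa> k \<rho>
    by (intro mult_left_mono mult_mono powr_mono2') auto
  finally have "norm (gradient u z) powr q \<le> (\<delta> * D) powr q"
    using \<open>1 < q\<close> by (intro powr_mono2) auto
  then have grad: "norm (gradient u z) powr q \<le> \<delta> powr q * D powr q"
    using \<open>0 < \<delta>\<close> \<open>0 < D\<close> by (simp add: powr_mult)
  have "2 * real DIM('a) * g' ((norm (z - y))\<^sup>2) + 4 * (norm (z - y))\<^sup>2 * g'' k
      \<le> 1 * laplacian u z + 0 * (norm (gradient u z))\<^sup>2"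
    by (rule touch(2)) (use k dg dg' min in \<open>auto simp: k_def \<kappa>_def\<close>)
  then have "2 * n * g' k + 4 * k * g'' k \<le> laplacian u z" by (simp add: n_def k_def \<kappa>_def)
  also have "laplacian u z \<le> - M * norm (gradient u z) powr q"
    using super[of z] z(1) \<open>V \<subseteq> S\<close> by force
  also have "\<dots> \<le> \<bar>M\<bar> * norm (gradient u z) powr q"
    by (intro mult_right_mono) auto
  also have "\<dots> \<le> \<bar>M\<bar> * (\<delta> powr q * D powr q)" using grad by (intro mult_left_mono) auto
  also have "\<delta> powr q = \<delta> * \<delta> powr (q - 1)" using \<open>0 < \<delta>\<close> by (simp add: powr_mult_base)
  also have "\<bar>M\<bar> * (\<delta> * \<delta> powr (q - 1) * D powr q) = \<delta> * (\<delta> powr (q - 1) * (\<bar>M\<bar> * D powr q))"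
    by simp
  also have "\<dots> < \<delta> * A" using \<delta> \<open>0 < \<delta>\<close> by (rule mult_strict_left_mono)
  also have "\<dots> \<le> \<delta> * ((2 * n\<^sup>2 + 4 * n) * k powr (- n - 1))"
    unfolding A_def using \<open>0 < \<delta>\<close> \<open>1 \<le> n\<close> k by (intro mult_left_mono powr_mono2') auto
  also have "\<dots> = 2 * n * g' k + 4 * k * g'' k"
  proof -
    have "k * k powr (- n - 2) = k powr (- n - 1)"
      using k powr_add[of k 1 "- n - 2"] by (simp add: minus_diff_commute)
    then have "4 * k * g'' k = 4 * \<delta> * n * (n + 1) * k powr (- n - 1)"
      unfolding g''_def by (metis mult.assoc mult.commute)
    then show ?thesis by (simp add: g'_def algebra_simps power2_eq_square)
  qed
  finally show False by simp
qed

text \<open>The positivity set is open by continuity. Its complement in \<open>S\<close> is open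
  too, since a positive value close to a zero would spread to that zero by the ball lemma;
  connectedness concludes.\<close>

lemma strong_positivity:
  fixes u :: "'a::euclidean_space \<Rightarrow> real"
  assumes C2: "C2_on S u" and S: "open S" "connected S" and "1 < q"
    and nonneg: "\<And>x. x \<in> S \<Longrightarrow> 0 \<le> u x"
    and super: "\<And>x. x \<in> S \<Longrightarrow> M * norm (gradient u x) powr q \<le> - laplacian u x"
    and "x0 \<in> S" "u x0 \<noteq> 0" and "x \<in> S"
  shows "0 < u x"
proof (rule ccontr)
  assume "\<not> 0 < u x"
  have cont: "continuous_on S u" by (rule C2_on_imp_continuous_on[OF C2])
  define W where "W = S \<inter> u -` {0<..}"
  have "open W" unfolding W_def by (rule continuous_open_preimage[OF cont S(1)]) simp
  have "open (S - W)"
    unfolding open_contains_ball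
  proof
    fix z assume z: "z \<in> S - W"
    then obtain r where r: "0 < r" "cball z r \<subseteq> S"
      using S(1) unfolding open_contains_cball by blast
    have "y \<in> S - W" if y: "y \<in> ball z (r / 3)" for y
    proof -
      have near: "dist z y < r / 3" using y by simp
      \<comment> \<open>Radius \<open>2 * r / 3\<close> is large enough for the ball about
        \<open>y\<close> to contain \<open>z\<close> and small enough to stay in
        \<open>cball z r\<close>.\<close>
      have sub: "cball y (2 * r / 3) \<subseteq> S"
      proof
        fix t assume "t \<in> cball y (2 * r / 3)"
        then have "dist z t \<le> r" using near dist_triangle[of z t y] by simp
        then show "t \<in> S" using r by auto
      qed
      have "\<not> 0 < u y"
      proof
        assume "0 < u y"
        have "0 < u z"
          by (rule positivity_in_ball[OF C2 sub \<open>1 < q\<close> nonneg super \<open>0 < u y\<close>])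
            (use near r in \<open>auto simp: dist_commute\<close>)
        with z show False by (simp add: W_def)
      qed
      moreover have "y \<in> S" using sub r by (auto simp: subset_iff)
      ultimately show ?thesis by (simp add: W_def)
    qed
    with r show "\<exists>e>0. ball z e \<subseteq> S - W" by (intro exI[of _ "r / 3"]) auto
  qed
  have "x0 \<in> W" using nonneg[of x0] \<open>x0 \<in> S\<close> \<open>u x0 \<noteq> 0\<close> by (simp add: W_def)
  moreover have "x \<in> S - W" using \<open>x \<in> S\<close> \<open>\<not> 0 < u x\<close> by (simp add: W_def)
  ultimately show False
    using connectedD[OF S(2) \<open>open W\<close> \<open>open (S - W)\<close>] \<open>x \<in> S\<close> by (auto simp: W_def)
qed

subsection \<open>Nonexistence\<close>

theorem theoremB:
  fixes N :: nat and p q M :: real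
  assumes "N = CARD('n::finite)"
    and "N \<ge> 2"
    and "p > 1"
    and "N \<ge> 3 \<Longrightarrow> p \<le> real N / (real N - 2)"
    and "q = 2 * p / (p + 1)"
    and "M > - mu_star N p"
  shows "\<not> (\<exists>(\<Omega> :: (real ^ 'n) set) (u :: real ^ 'n \<Rightarrow> real).
            exterior_domain \<Omega> \<and>
            supersolution p q M \<Omega> u \<and>
            (\<forall>x\<in>\<Omega>. u x \<ge> 0) \<and>
            (\<exists>x\<in>\<Omega>. u x \<noteq> 0))"
proof
  assume "\<exists>(\<Omega> :: (real ^ 'n) set) (u :: real ^ 'n \<Rightarrow> real).
            exterior_domain \<Omega> \<and>
            supersolution p q M \<Omega> u \<and>
            (\<forall>x\<in>\<Omega>. u x \<ge> 0) \<and>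
            (\<exists>x\<in>\<Omega>. u x \<noteq> 0)"
  then obtain \<Omega> :: "(real ^ 'n) set" and u :: "real ^ 'n \<Rightarrow> real" and x0
    where \<Omega>: "exterior_domain \<Omega>" and super: "supersolution p q M \<Omega> u"
      and nonneg: "\<And>x. x \<in> \<Omega> \<Longrightarrow> 0 \<le> u x" and x0: "x0 \<in> \<Omega>" "u x0 \<noteq> 0" by blast
  have C2: "C2_on \<Omega> u" using super by (simp add: supersolution_def)
  have ineq: "\<bar>u x\<bar> powr (p - 1) * u x + M * norm (gradient u x) powr q \<le> - laplacian u x"
    if "x \<in> \<Omega>" for x using super that by (simp add: supersolution_def)
  have "1 < q" unfolding assms(5) using assms(3) by (subst pos_less_divide_eq) auto
  have pos: "0 < u x" if "x \<in> \<Omega>" for x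
  proof (rule strong_positivity[OF C2 _ _ \<open>1 < q\<close> nonneg _ x0 that])
    show "M * norm (gradient u z) powr q \<le> - laplacian u z" if "z \<in> \<Omega>" for z
      using ineq[OF that] nonneg[OF that] by (smt (verit) mult_nonneg_nonneg powr_ge_zero)
  qed (use \<Omega> in \<open>auto simp: exterior_domain_def\<close>)
  \<comment> \<open>\<open>C / p\<close> is the base of the power in \<open>mu_star\<close>. The
    upper bound on \<open>p\<close> gives \<open>0 \<le> C\<close>, and
    \<open>2 * C = 2 - (N - 2) * (p - 1)\<close> gives \<open>C \<le> 1\<close>.\<close>
  define C where "C = (real N - (real N - 2) * p) / 2"
  have "0 \<le> C"
  proof (cases "N \<ge> 3")
    case True
    then have "p * (real N - 2) \<le> real N" using assms(4)[OF True] by (subst (asm) pos_le_divide_eq) auto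
    then show ?thesis by (simp add: C_def mult.commute)
  next
    case False
    then have "N = 2" using assms(2) by simp
    then show ?thesis by (simp add: C_def)
  qed
  have "(real N - 2) * 1 \<le> (real N - 2) * p" using assms(2,3) by (intro mult_left_mono) auto
  then have "C \<le> 1" by (simp add: C_def)
  have "- ((p + 1) * (C / p) powr (p / (p + 1))) < M"
    using assms(6) by (simp add: mu_star_def C_def)
  then obtain c e where c: "0 \<le> c" "c < 1" "c \<le> C" and "0 < e" and absorb:
    "\<And>w G. 0 < w \<Longrightarrow> 0 \<le> G \<Longrightarrow> e * w powr p - c * (G\<^sup>2 / w) \<le> w powr p + M * G powr q"
    using gradient_term_absorption[OF assms(3) \<open>0 \<le> C\<close> \<open>C \<le> 1\<close> assms(5)] by blast
  define s where "s = 1 - c"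
  have "0 < s" using c by (simp add: s_def)
  have touching: "touching_supersolution (s * e) ((p + s - 1) / s) \<Omega> (\<lambda>x. u x powr s)"
  proof (rule power_touching_supersolution[OF C2 \<open>0 < s\<close> pos])
    fix x assume x: "x \<in> \<Omega>"
    have "u x powr p = \<bar>u x\<bar> powr (p - 1) * u x" using pos[OF x] by (simp add: powr_diff)
    with absorb[OF pos[OF x] norm_ge_zero] ineq[OF x]
    show "e * u x powr p - (1 - s) * ((norm (gradient u x))\<^sup>2 / u x) \<le> - laplacian u x"
      unfolding s_def by (smt (verit))
  qed
  obtain K where K: "compact K" "\<Omega> = - K" using \<Omega> by (auto simp: exterior_domain_def)
  then obtain R0 where R0: "\<And>x. x \<in> K \<Longrightarrow> norm x \<le> R0"
    using compact_imp_bounded bounded_iff by metis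
  \<comment> \<open>The margin 1 puts even the closed exterior \<open>R \<le> norm x\<close> inside
    \<open>\<Omega>\<close>; \<open>1 \<le> R\<close> keeps the logarithms nonnegative.\<close>
  define R where "R = max 1 (R0 + 1)"
  have sub: "{x. R \<le> norm x} \<subseteq> \<Omega>" using R0 K(2) by (force simp: R_def)
  show False
  proof (rule no_positive_touching_supersolution)
    show "touching_supersolution (s * e) ((p + s - 1) / s) {x. R < norm x} (\<lambda>x. u x powr s)"
      using sub by (intro touching_supersolution_subset[OF touching]) auto
    have "continuous_on {x. R \<le> norm x} u"
      by (rule continuous_on_subset[OF C2_on_imp_continuous_on[OF C2] sub])
    then show "continuous_on {x. R \<le> norm x} (\<lambda>x. u x powr s)"
      using pos sub by (intro continuous_intros) force+
    show "0 < u x powr s" if "R \<le> norm x" for x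
      using pos[of x] sub that by auto
    show "1 \<le> R" by (simp add: R_def)
    show "0 < s * e" using \<open>0 < s\<close> \<open>0 < e\<close> by simp
    show "0 < s / (p - 1)" using \<open>0 < s\<close> assms(3) by simp
    \<comment> \<open>This is \<open>c \<le> C\<close> rewritten. With
      \<open>b = s / (p - 1)\<close>, half of the exponent \<beta>, it is the condition under which
      the power barrier is subharmonic.\<close>
    have "(real N - 2) * (p - 1) \<le> 2 * s"
      using c(3) by (simp add: s_def C_def algebra_simps)
    then have "real N - 2 \<le> 2 * (s / (p - 1))" using assms(3) by (simp add: pos_le_divide_eq)
    then show "real DIM(real ^ 'n) - 2 \<le> 2 * (s / (p - 1))" using assms(1) by simp
    show "(p + s - 1) / s = 1 + 1 / (s / (p - 1))" using \<open>0 < s\<close> by (simp add: field_simps)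
  qed
qed

end
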